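(* Let $K\subset\mathbb{R}^n$ be a convex body and let $\nu\in\mathbb{S}^{n-1}$. For any $p\in\mathbb{R}$ and any $u\in\nu^\perp$, the slicing support function $h_\nu$ of $K$ satisfies $$h_\nu(u,p)=\inf_{\lambda\in\mathbb{R}}\bigl\{h_K(u+\lambda\nu)-\lambda p\bigr\},$$ as an identity in $[-\infty,\infty)$.
   Context: For a convex body $K\subset\mathbb{R}^n$, the support function is $h_K(v)=\sup_{x\in K}x\cdot v$, $v\in\mathbb{R}^n$. For a unit vector $\nu\in\mathbb{S}^{n-1}$ write $\nu^\perp=\{x\in\mathbb{R}^n: x\cdot\nu=0\}$, and for $p\in\mathbb{R}$ let $C(\nu,p)=K\cap\{x\in\mathbb{R}^n: x\cdot\nu=p\}$ (possibly empty). The slicing support function is $h_\nu(u,p)=\sup_{x\in C(\nu,p)}x\cdot u$ for $u\in\nu^\perp$, $p\in\mathbb{R}$, with the convention $h_\nu(u,p)=-\infty$ if $C(\nu,p)=\emptyset$. *)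

theory Defs
  imports "HOL-Analysis.Analysis"
begin

text \<open>Lower-dimensional bodies are allowed; a nonempty interior is not required.\<close>
definition convex_body :: "(real ^ 'n) set \<Rightarrow> bool" where
  "convex_body K \<longleftrightarrow> compact K \<and> convex K \<and> K \<noteq> {}"

text \<open>The supremum is taken in the extended reals, so that its value on the empty set
  is \<open>-\<infinity>\<close>; on convex bodies it is a real number (see \<open>support_function_finite\<close>).\<close>
definition support_function :: "(real ^ 'n) set \<Rightarrow> real ^ 'n \<Rightarrow> ereal" where
  "support_function K v = (SUP x\<in>K. ereal (x \<bullet> v))"

definition orth_hyperplane :: "real ^ 'n \<Rightarrow> (real ^ 'n) set" where
  "orth_hyperplane \<nu> = {x. x \<bullet> \<nu> = 0}"

definition slice :: "(real ^ 'n) set \<Rightarrow> real ^ 'n \<Rightarrow> real \<Rightarrow> (real ^ 'n) set" where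
  "slice K \<nu> p = K \<inter> {x. x \<bullet> \<nu> = p}"

definition slicing_support_function ::
  "(real ^ 'n) set \<Rightarrow> real ^ 'n \<Rightarrow> real ^ 'n \<Rightarrow> real \<Rightarrow> ereal" where
  "slicing_support_function K \<nu> u p = (SUP x\<in>slice K \<nu> p. ereal (x \<bullet> u))"

lemma slicing_support_function_empty:
  "slice K \<nu> p = {} \<Longrightarrow> slicing_support_function K \<nu> u p = -\<infinity>"
  by (simp add: slicing_support_function_def bot_ereal_def)

lemma support_function_finite:
  assumes "convex_body K"
  shows "\<bar>support_function K v\<bar> \<noteq> \<infinity>"
proof -
  have "compact K" "K \<noteq> {}"
    using assms by (auto simp: convex_body_def)
  moreover have "continuous_on K (\<lambda>x. x \<bullet> v)"
    by (intro continuous_intros)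
  ultimately obtain x where x: "x \<in> K" "\<forall>y\<in>K. y \<bullet> v \<le> x \<bullet> v"
    using continuous_attains_sup by blast
  have "support_function K v = ereal (x \<bullet> v)"
    unfolding support_function_def using x by (intro antisym SUP_least SUP_upper) auto
  then show ?thesis by simp
qed

end

theory Submission
  imports Defs
begin

text \<open>Only the inequality \<open>\<ge>\<close> needs convexity. For \<open>c > h\<^sub>\<nu>(u, p)\<close> the planar image of \<open>K\<close> under
  \<open>x \<mapsto> (x \<bullet> \<nu> - p, x \<bullet> u)\<close> misses the closed vertical ray \<open>{0} \<times> [c, \<infinity>)\<close>, so a line strictly
  separates the two. If it is not vertical, its slope is the required \<open>\<lambda>\<close>; if it is vertical, the
  hyperplane \<open>x \<bullet> \<nu> = p\<close> misses \<open>K\<close>, and a large multiple of the normal works.\<close>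

lemma slice_bound_multiplier:
  fixes K :: "'a::euclidean_space set"
  assumes "compact K" "convex K" "K \<noteq> {}"
    and slice_bound: "\<And>x. x \<in> K \<Longrightarrow> x \<bullet> \<nu> = p \<Longrightarrow> x \<bullet> u < c"
  obtains t where "\<And>x. x \<in> K \<Longrightarrow> x \<bullet> u + t * (x \<bullet> \<nu> - p) \<le> c"
proof -
  let ?f = "\<lambda>x. (x \<bullet> \<nu>, x \<bullet> u)"
  let ?S = "?f ` K" and ?T = "{p} \<times> {c..}"
  have "linear ?f"
    by (intro linearI) (auto simp: inner_add_left)
  then have "convex ?S"
    using assms by (simp add: convex_linear_image)
  moreover have "compact ?S"
    using assms by (intro compact_continuous_image continuous_intros)
  moreover have "convex ?T" "closed ?T"
    by (auto intro: convex_Times closed_Times)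
  moreover have "?S \<inter> ?T = {}"
    using slice_bound by force
  ultimately obtain a b where S: "\<And>z. z \<in> ?S \<Longrightarrow> a \<bullet> z < b" and T: "\<And>z. z \<in> ?T \<Longrightarrow> b < a \<bullet> z"
    using separating_hyperplane_compact_closed[of ?S ?T] assms(3) by blast
  obtain a1 a2 where a: "a = (a1, a2)"
    by fastforce
  have S': "a1 * (x \<bullet> \<nu>) + a2 * (x \<bullet> u) < b" if "x \<in> K" for x
    using S[of "?f x"] that by (simp add: a)
  have T': "b < a1 * p + a2 * y" if "y \<ge> c" for y
    using T[of "(p, y)"] that by (simp add: a)
  \<comment> \<open>The ray is unbounded upwards and must stay on the side above \<open>b\<close>,
    which a negative \<open>a2\<close> would prevent: far enough up, at the \<open>y\<close> chosen
    below, \<open>a1 * p + a2 * y\<close> has dropped to \<open>b\<close> or less. The maximum with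
    \<open>c\<close> keeps \<open>y\<close> on the ray.\<close>
  have "a2 \<ge> 0"
  proof (rule ccontr)
    assume "\<not> a2 \<ge> 0"
    then have "a2 < 0" by simp
    define y where "y = max c ((b - a1 * p) / a2)"
    have "a2 * y \<le> a2 * ((b - a1 * p) / a2)"
      using \<open>a2 < 0\<close> by (intro mult_left_mono_neg) (auto simp: y_def)
    with \<open>a2 < 0\<close> T'[of y] show False
      by (simp add: y_def)
  qed
  then consider "a2 > 0" | "a2 = 0" by linarith
  then show thesis
  proof cases
    case 1
    \<comment> \<open>Compare \<open>K\<close> with the endpoint \<open>(p, c)\<close> of the ray
      through the common bound \<open>b\<close>, then divide by \<open>a2\<close>.\<close>
    have "x \<bullet> u + a1 / a2 * (x \<bullet> \<nu> - p) \<le> c" if "x \<in> K" for x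
    proof -
      have "a2 * (x \<bullet> u) + a1 * (x \<bullet> \<nu> - p) \<le> a2 * c"
        using S'[OF that] T'[of c] by (simp add: algebra_simps)
      with 1 show ?thesis
        by (simp add: field_simps)
    qed
    then show thesis by (rule that)
  next
    case 2
    \<comment> \<open>Strict separation leaves a positive margin \<open>d\<close> that is uniform
      over \<open>K\<close>.\<close>
    define d where "d = a1 * p - b"
    have "d > 0"
      using T'[of c] 2 by (simp add: d_def)
    have gap: "a1 * (x \<bullet> \<nu> - p) \<le> - d" if "x \<in> K" for x
      using S'[OF that] 2 by (simp add: d_def algebra_simps)
    have "bounded ((\<lambda>x. x \<bullet> u) ` K)"
      using assms by (intro compact_imp_bounded compact_continuous_image continuous_intros)
    then obtain M where M: "\<And>x. x \<in> K \<Longrightarrow> x \<bullet> u \<le> M"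
      unfolding bounded_real by (meson abs_le_D1 imageI)
    \<comment> \<open>Scaling the margin by \<open>s\<close> must outweigh the largest excess
      \<open>M - c\<close> of \<open>x \<bullet> u\<close> over \<open>c\<close>; the maximum with 0
      lets \<open>gap\<close> be multiplied by \<open>s\<close> without reversing it.\<close>
    define s where "s = max 0 ((M - c) / d)"
    have "s \<ge> 0" "M - c \<le> s * d"
      using \<open>d > 0\<close> by (auto simp: s_def simp flip: pos_divide_le_eq)
    have "x \<bullet> u + s * a1 * (x \<bullet> \<nu> - p) \<le> c" if "x \<in> K" for x
      using mult_left_mono[OF gap[OF that] \<open>s \<ge> 0\<close>] M[OF that] \<open>M - c \<le> s * d\<close>
      by (simp add: mult.assoc)
    then show thesis by (rule that)
  qed
qed

lemma slicing_le_support_function: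
  "slicing_support_function K \<nu> u p \<le> support_function K (u + t *\<^sub>R \<nu>) - ereal (t * p)"
  unfolding slicing_support_function_def
proof (rule SUP_least)
  fix x assume "x \<in> slice K \<nu> p"
  then have x: "x \<in> K" "x \<bullet> \<nu> = p"
    by (auto simp: slice_def)
  have "ereal (x \<bullet> (u + t *\<^sub>R \<nu>)) \<le> support_function K (u + t *\<^sub>R \<nu>)"
    unfolding support_function_def using x by (intro SUP_upper)
  then have "ereal (x \<bullet> (u + t *\<^sub>R \<nu>)) - ereal (t * p)
      \<le> support_function K (u + t *\<^sub>R \<nu>) - ereal (t * p)"
    by (intro ereal_minus_mono) auto
  then show "ereal (x \<bullet> u) \<le> support_function K (u + t *\<^sub>R \<nu>) - ereal (t * p)"
    using x by (simp add: inner_add_right)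
qed

theorem proposition1:
  fixes K :: "(real ^ 'n) set" and \<nu> u :: "real ^ 'n" and p :: real
  assumes "convex_body K"
    and "\<nu> \<in> sphere 0 1"
    and "u \<in> orth_hyperplane \<nu>"
  shows "slicing_support_function K \<nu> u p < \<infinity> \<and>
         slicing_support_function K \<nu> u p
           = (INF t::real. support_function K (u + t *\<^sub>R \<nu>) - ereal (t * p))"
proof
  let ?h = "slicing_support_function K \<nu> u p"
  let ?g = "\<lambda>t. support_function K (u + t *\<^sub>R \<nu>) - ereal (t * p)"
  have "?h \<le> support_function K u"
    using slicing_le_support_function[of K \<nu> u p 0] by (simp flip: zero_ereal_def)
  also have "\<dots> < \<infinity>"
    using support_function_finite[OF assms(1), of u] by auto
  finally show "?h < \<infinity>" .
  show "?h = (INF t. ?g t)"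
  proof (rule antisym)
    show "?h \<le> (INF t. ?g t)"
      by (intro INF_greatest slicing_le_support_function)
    show "(INF t. ?g t) \<le> ?h"
    \<comment> \<open>Testing against every \<open>z\<close> above \<open>?h\<close> also covers an
      empty slice: \<open>?h\<close> is then -\<infinity>, every real \<open>c\<close> is
      admissible, and the infimum is driven down to -\<infinity>.\<close>
    proof (rule dense_ge)
      fix z assume "?h < z"
      show "(INF t. ?g t) \<le> z"
      proof (cases z)
        case (real c)
        have "x \<bullet> u < c" if "x \<in> K" "x \<bullet> \<nu> = p" for x
        proof -
          have "ereal (x \<bullet> u) \<le> ?h"
            unfolding slicing_support_function_def
            using that by (intro SUP_upper) (simp add: slice_def)
          also note \<open>?h < z\<close>
          finally show ?thesis
            by (simp add: real)
        qed
        moreover have "compact K" "convex K" "K \<noteq> {}"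
          using assms(1) by (auto simp: convex_body_def)
        ultimately obtain t where t: "\<And>x. x \<in> K \<Longrightarrow> x \<bullet> u + t * (x \<bullet> \<nu> - p) \<le> c"
          using slice_bound_multiplier by blast
        have "support_function K (u + t *\<^sub>R \<nu>) \<le> ereal (c + t * p)"
          unfolding support_function_def
        proof (rule SUP_least)
          fix x assume "x \<in> K"
          from t[OF this] show "ereal (x \<bullet> (u + t *\<^sub>R \<nu>)) \<le> ereal (c + t * p)"
            by (simp add: inner_add_right algebra_simps)
        qed
        then have "?g t \<le> ereal (c + t * p) - ereal (t * p)"
          by (intro ereal_minus_mono) auto
        then have "?g t \<le> z"
          by (simp add: real)
        then show ?thesis
          by (rule INF_lower2[OF UNIV_I])
      qed (use \<open>?h < z\<close> in auto)
    qed
  qed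
qed

end
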